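(* Let $(k_n)_{n\ge1}$ be a sequence of positive integers and let $\theta_{k_n,i_n}$ be a bijection of $\{0,1\}^{k_n}$ for each $n$. The Lebesgue integral over $[0,1]$ of the associated function $f_{2'}$ is equal to $\frac12$.
   Context: Empty sums of $k_i$ are $0$. For binary digits $\alpha_j\in\{0,1\}$ put $\Delta^2_{\alpha_1\alpha_2\ldots}=\sum_{j\ge1}\alpha_j2^{-j}$. The function $f_{2'}:[0,1]\to[0,1]$ sends $x=\Delta^2_{\alpha_1\alpha_2\ldots}$ to $\sum_{j\ge1}\beta_j2^{-j}$, where $(\beta_{k_1+\cdots+k_{n-1}+1},\ldots,\beta_{k_1+\cdots+k_n})=\theta_{k_n,i_n}(\alpha_{k_1+\cdots+k_{n-1}+1},\ldots,\alpha_{k_1+\cdots+k_n})$ for all $n\ge1$. For well-definedness, binary representations with period $(1)$ (ending in $111\ldots$) are not used, except for the number $1$. *)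

theory Defs
  imports "HOL-Analysis.Analysis"
begin

text \<open>Binary digit sequences are indexed from 1, as in the mathematical notation; extensionality of
  \<open>\<rightarrow>\<^sub>E\<close> fixes the irrelevant value at index 0, so that equality of sequences is equality of digits.\<close>

definition binary_seqs :: "(nat \<Rightarrow> nat) set" where
  "binary_seqs = {1..} \<rightarrow>\<^sub>E {0, 1}"

definition binary_words :: "nat \<Rightarrow> nat list set" where
  "binary_words m = {xs. set xs \<subseteq> {0, 1} \<and> length xs = m}"

definition binary_value :: "(nat \<Rightarrow> nat) \<Rightarrow> real" where
  "binary_value \<alpha> = (\<Sum>i. real (\<alpha> (Suc i)) / 2 ^ Suc i)"

text \<open>Representations ending in \<open>111\<dots>\<close> are excluded, except for the number 1.\<close>

definition is_binary_rep :: "real \<Rightarrow> (nat \<Rightarrow> nat) \<Rightarrow> bool" where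
  "is_binary_rep x \<alpha> \<longleftrightarrow> \<alpha> \<in> binary_seqs \<and> x = binary_value \<alpha> \<and>
     (x \<noteq> 1 \<longrightarrow> \<not> (\<exists>N. \<forall>j>N. \<alpha> j = 1))"

definition binary_digits :: "real \<Rightarrow> nat \<Rightarrow> nat" where
  "binary_digits x = (THE \<alpha>. is_binary_rep x \<alpha>)"

definition block :: "(nat \<Rightarrow> nat) \<Rightarrow> nat \<Rightarrow> nat list" where
  "block k n = [(\<Sum>i=1..n-1. k i) + 1 ..< (\<Sum>i=1..n. k i) + 1]"

definition is_block_image ::
  "(nat \<Rightarrow> nat) \<Rightarrow> (nat \<Rightarrow> nat list \<Rightarrow> nat list) \<Rightarrow> (nat \<Rightarrow> nat) \<Rightarrow> (nat \<Rightarrow> nat) \<Rightarrow> bool" where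
  "is_block_image k \<theta> \<alpha> \<beta> \<longleftrightarrow> \<beta> \<in> binary_seqs \<and>
     (\<forall>n\<ge>1. map \<beta> (block k n) = \<theta> n (map \<alpha> (block k n)))"

definition block_image ::
  "(nat \<Rightarrow> nat) \<Rightarrow> (nat \<Rightarrow> nat list \<Rightarrow> nat list) \<Rightarrow> (nat \<Rightarrow> nat) \<Rightarrow> nat \<Rightarrow> nat" where
  "block_image k \<theta> \<alpha> = (THE \<beta>. is_block_image k \<theta> \<alpha> \<beta>)"

text \<open>Only the values on \<open>{0..1}\<close> are meaningful.\<close>

definition block_bijection_fun ::
  "(nat \<Rightarrow> nat) \<Rightarrow> (nat \<Rightarrow> nat list \<Rightarrow> nat list) \<Rightarrow> real \<Rightarrow> real" where
  "block_bijection_fun k \<theta> x = binary_value (block_image k \<theta> (binary_digits x))"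

text \<open>The two definite descriptions above are well defined.\<close>

lemma binary_summable:
  assumes "\<alpha> \<in> binary_seqs"
  shows "summable (\<lambda>i. real (\<alpha> (Suc i)) / 2 ^ Suc i)"
proof (rule summable_comparison_test')
  show "summable (\<lambda>i. (1/2::real) ^ Suc i)"
    by (simp add: summable_geometric)
  fix i :: nat
  have "\<alpha> (Suc i) \<in> {0,1}" using assms by (auto simp: binary_seqs_def PiE_def Pi_def)
  then show "norm (real (\<alpha> (Suc i)) / 2 ^ Suc i) \<le> (1/2) ^ Suc i"
    by (auto simp: power_divide)
qed

lemma geometric_half_sums: "(\<lambda>i. 1 / 2 ^ Suc i :: real) sums 1"
  using power_half_series by (simp add: power_divide)

lemma binary_value_le_1:
  assumes "\<alpha> \<in> binary_seqs"
  shows "binary_value \<alpha> \<le> 1"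
    and "binary_value \<alpha> = 1 \<Longrightarrow> j \<ge> 1 \<Longrightarrow> \<alpha> j = 1"
proof -
  have d: "\<alpha> (Suc i) \<in> {0,1}" for i
    using assms by (auto simp: binary_seqs_def PiE_def Pi_def)
  have "(\<lambda>i. 1 / 2 ^ Suc i - real (\<alpha> (Suc i)) / 2 ^ Suc i) sums (1 - binary_value \<alpha>)"
    unfolding binary_value_def
    by (intro sums_diff geometric_half_sums summable_sums binary_summable assms)
  then have s: "(\<lambda>i. (1 - real (\<alpha> (Suc i))) / 2 ^ Suc i) sums (1 - binary_value \<alpha>)"
    by (simp add: diff_divide_distrib)
  have nn: "(1 - real (\<alpha> (Suc i))) / 2 ^ Suc i \<ge> 0" for i
    using d[of i] by auto
  show "binary_value \<alpha> \<le> 1"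
    using suminf_nonneg[OF sums_summable[OF s] nn] sums_unique[OF s] by simp
  assume v: "binary_value \<alpha> = 1" and j: "j \<ge> 1"
  then obtain i where i: "j = Suc i" by (cases j) auto
  have "(\<Sum>i. (1 - real (\<alpha> (Suc i))) / 2 ^ Suc i) = 0"
    using sums_unique[OF s] v by simp
  then have "\<forall>i. (1 - real (\<alpha> (Suc i))) / 2 ^ Suc i = 0"
    using suminf_eq_zero_iff[OF sums_summable[OF s] nn] by blast
  then have "(1 - real (\<alpha> (Suc i))) / 2 ^ Suc i = 0" by blast
  then show "\<alpha> j = 1" using i by simp
qed

lemma binary_value_floor:
  assumes "\<alpha> \<in> binary_seqs" and "\<not> (\<exists>N. \<forall>j>N. \<alpha> j = 1)"
  shows "\<lfloor>2 ^ n * binary_value \<alpha>\<rfloor> = (\<Sum>i<n. int (\<alpha> (Suc i)) * 2 ^ (n - Suc i))"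
proof -
  let ?g = "\<lambda>j. if j = 0 then undefined else \<alpha> (j + n)"
  have g: "?g \<in> binary_seqs"
    using assms(1) by (auto simp: binary_seqs_def PiE_def Pi_def extensional_def)
  have g0: "binary_value ?g \<ge> 0"
    unfolding binary_value_def by (intro suminf_nonneg binary_summable g) auto
  have g1: "binary_value ?g \<noteq> 1"
  proof
    assume "binary_value ?g = 1"
    then have *: "?g j = 1" if "j \<ge> 1" for j
      using binary_value_le_1(2)[OF g] that by blast
    have "\<alpha> j = 1" if "j > n" for j
      using *[of "j - n"] that by auto
    then show False using assms(2) by blast
  qed
  have "binary_value \<alpha> = (\<Sum>i. real (\<alpha> (Suc (i + n))) / 2 ^ Suc (i + n)) +
      (\<Sum>i<n. real (\<alpha> (Suc i)) / 2 ^ Suc i)"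
    unfolding binary_value_def
    by (rule suminf_split_initial_segment[OF binary_summable[OF assms(1)]])
  also have "(\<Sum>i. real (\<alpha> (Suc (i + n))) / 2 ^ Suc (i + n)) = binary_value ?g / 2 ^ n"
    unfolding binary_value_def
    by (subst suminf_divide[OF binary_summable[OF g], symmetric]) (simp add: power_add mult_ac)
  finally have "2 ^ n * binary_value \<alpha> =
      binary_value ?g + (\<Sum>i<n. 2 ^ n * (real (\<alpha> (Suc i)) / 2 ^ Suc i))"
    by (simp add: distrib_left sum_distrib_left)
  also have "(\<Sum>i<n. 2 ^ n * (real (\<alpha> (Suc i)) / 2 ^ Suc i)) =
      (\<Sum>i<n. real (\<alpha> (Suc i)) * 2 ^ (n - Suc i))"
    by (intro sum.cong refl) (auto simp: power_diff)
  finally have "2 ^ n * binary_value \<alpha> =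
      binary_value ?g + of_int (\<Sum>i<n. int (\<alpha> (Suc i)) * 2 ^ (n - Suc i))"
    by simp
  moreover have "binary_value ?g < 1"
    using g1 binary_value_le_1(1)[OF g] by linarith
  ultimately show ?thesis
    using g0 by linarith
qed

lemma binary_rep_unique:
  assumes "is_binary_rep x \<alpha>" and "is_binary_rep x \<beta>"
  shows "\<alpha> = \<beta>"
proof (rule PiE_ext)
  show "\<alpha> \<in> {1..} \<rightarrow>\<^sub>E {0,1}" "\<beta> \<in> {1..} \<rightarrow>\<^sub>E {0,1}"
    using assms by (auto simp: is_binary_rep_def binary_seqs_def)
  fix j :: nat assume j: "j \<in> {1..}"
  show "\<alpha> j = \<beta> j"
  proof (cases "x = 1")
    case True
    then have "\<alpha> j = 1" "\<beta> j = 1"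
      using assms j binary_value_le_1(2)[of \<alpha> j] binary_value_le_1(2)[of \<beta> j]
      by (simp_all add: is_binary_rep_def)
    then show ?thesis by simp
  next
    case False
    obtain n where n: "j = Suc n" using j by (cases j) auto
    have *: "int (\<gamma> j) = \<lfloor>2 ^ j * x\<rfloor> - 2 * \<lfloor>2 ^ n * x\<rfloor>" if "is_binary_rep x \<gamma>" for \<gamma>
    proof -
      have f: "\<lfloor>2 ^ m * x\<rfloor> = (\<Sum>i<m. int (\<gamma> (Suc i)) * 2 ^ (m - Suc i))" for m
        using binary_value_floor[of \<gamma> m] that False by (auto simp: is_binary_rep_def)
      have "(\<Sum>i<n. int (\<gamma> (Suc i)) * 2 ^ (j - Suc i)) =
          2 * (\<Sum>i<n. int (\<gamma> (Suc i)) * 2 ^ (n - Suc i))"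
        unfolding sum_distrib_left
      proof (intro sum.cong refl)
        fix i assume "i \<in> {..<n}"
        then have "j - Suc i = Suc (n - Suc i)" using n by auto
        then show "int (\<gamma> (Suc i)) * 2 ^ (j - Suc i) = 2 * (int (\<gamma> (Suc i)) * 2 ^ (n - Suc i))"
          by simp
      qed
      then show ?thesis unfolding f by (simp add: n)
    qed
    show ?thesis using *[OF assms(1)] *[OF assms(2)] by simp
  qed
qed

lemma binary_rep_exists:
  assumes "x \<in> {0..1}"
  shows "\<exists>\<alpha>. is_binary_rep x \<alpha>"
proof (cases "x = 1")
  case True
  have "binary_value (\<lambda>j. if j = 0 then undefined else 1) = 1"
    using sums_unique[OF geometric_half_sums] by (simp add: binary_value_def)
  then show ?thesis
    using True
    by (intro exI[of _ "\<lambda>j. if j = 0 then undefined else 1"])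
       (auto simp: is_binary_rep_def binary_seqs_def PiE_def Pi_def extensional_def)
next
  case False
  then have x: "0 \<le> x" "x < 1" using assms by auto
  define \<alpha> where "\<alpha> j = (if j = 0 then undefined else nat (\<lfloor>2 ^ j * x\<rfloor> mod 2))" for j :: nat
  have seq: "\<alpha> \<in> binary_seqs"
  proof -
    have "\<alpha> j \<in> {0,1}" if "j \<ge> 1" for j
      using that unfolding \<alpha>_def by auto
    then show ?thesis
      by (auto simp: binary_seqs_def PiE_def Pi_def extensional_def \<alpha>_def)
  qed
  have half: "\<lfloor>2 ^ Suc n * x\<rfloor> = 2 * \<lfloor>2 ^ n * x\<rfloor> + int (\<alpha> (Suc n))" for n
  proof -
    have "\<lfloor>2 ^ Suc n * x\<rfloor> div 2 = \<lfloor>2 ^ n * x\<rfloor>"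
      using floor_divide_real_eq_div[of 2 "2 ^ Suc n * x"] by simp
    moreover have "int (\<alpha> (Suc n)) = \<lfloor>2 ^ Suc n * x\<rfloor> mod 2"
      by (simp add: \<alpha>_def)
    ultimately show ?thesis
      by (metis mult_div_mod_eq)
  qed
  have partial: "(\<Sum>i<n. real (\<alpha> (Suc i)) / 2 ^ Suc i) = of_int \<lfloor>2 ^ n * x\<rfloor> / 2 ^ n" for n
  proof (induction n)
    case 0
    have "\<lfloor>x\<rfloor> = 0" using x by linarith
    then show ?case by simp
  next
    case (Suc n)
    have "(of_int \<lfloor>2 ^ Suc n * x\<rfloor> :: real) = 2 * of_int \<lfloor>2 ^ n * x\<rfloor> + real (\<alpha> (Suc n))"
      by (simp only: half of_int_add of_int_mult of_int_numeral of_int_of_nat_eq)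
    then show ?case
      using Suc by (simp add: field_simps)
  qed
  have "(\<lambda>n. of_int \<lfloor>2 ^ n * x\<rfloor> / 2 ^ n) \<longlonglongrightarrow> x"
  proof (rule tendsto_sandwich)
    show "\<forall>\<^sub>F n in sequentially. x - (1/2) ^ n \<le> of_int \<lfloor>2 ^ n * x\<rfloor> / 2 ^ n"
    proof (intro always_eventually allI)
      fix n :: nat
      have "2 ^ n * x - 1 \<le> of_int \<lfloor>2 ^ n * x\<rfloor>" by linarith
      then have "(2 ^ n * x - 1) / 2 ^ n \<le> of_int \<lfloor>2 ^ n * x\<rfloor> / 2 ^ n"
        by (rule divide_right_mono) simp
      then show "x - (1/2) ^ n \<le> of_int \<lfloor>2 ^ n * x\<rfloor> / 2 ^ n"
        by (simp add: diff_divide_distrib power_divide)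
    qed
    show "\<forall>\<^sub>F n in sequentially. of_int \<lfloor>2 ^ n * x\<rfloor> / 2 ^ n \<le> x"
    proof (intro always_eventually allI)
      fix n :: nat
      have "of_int \<lfloor>2 ^ n * x\<rfloor> \<le> 2 ^ n * x" by linarith
      then show "of_int \<lfloor>2 ^ n * x\<rfloor> / 2 ^ n \<le> x"
        by (simp add: field_simps)
    qed
    have "(\<lambda>n. x - (1/2::real) ^ n) \<longlonglongrightarrow> x - 0"
      by (intro tendsto_diff tendsto_const LIMSEQ_realpow_zero) auto
    then show "(\<lambda>n. x - (1/2::real) ^ n) \<longlonglongrightarrow> x" by simp
  qed auto
  then have "(\<lambda>i. real (\<alpha> (Suc i)) / 2 ^ Suc i) sums x"
    unfolding sums_def partial .
  then have val: "binary_value \<alpha> = x"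
    unfolding binary_value_def by (rule sums_unique[symmetric])
  have "\<not> (\<exists>N. \<forall>j>N. \<alpha> j = 1)"
  proof
    assume "\<exists>N. \<forall>j>N. \<alpha> j = 1"
    then obtain N where N: "\<And>j. j > N \<Longrightarrow> \<alpha> j = 1" by blast
    define c where "c = 2 ^ N * x - of_int \<lfloor>2 ^ N * x\<rfloor>"
    have c1: "c < 1" unfolding c_def by linarith
    have c2: "2 ^ (N + m) * x - of_int \<lfloor>2 ^ (N + m) * x\<rfloor> = 2 ^ m * (c - 1) + 1" for m
    proof (induction m)
      case (Suc m)
      have "\<lfloor>2 ^ (N + Suc m) * x\<rfloor> = 2 * \<lfloor>2 ^ (N + m) * x\<rfloor> + 1"
        using half[of "N + m"] N[of "Suc (N + m)"] by simp
      then have "2 ^ (N + Suc m) * x - of_int \<lfloor>2 ^ (N + Suc m) * x\<rfloor> =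
          2 * (2 ^ (N + m) * x - of_int \<lfloor>2 ^ (N + m) * x\<rfloor>) - 1"
        by simp
      then show ?case unfolding Suc by simp
    qed (simp add: c_def)
    obtain m where m: "1 / (1 - c) < 2 ^ m"
      using real_arch_pow[of 2 "1 / (1 - c)"] by auto
    then have "1 < 2 ^ m * (1 - c)" using c1 by (simp add: field_simps)
    then have "2 ^ m * (c - 1) + 1 < 0" by (simp add: algebra_simps)
    then show False unfolding c2[symmetric] by linarith
  qed
  then show ?thesis
    using seq val by (auto simp: is_binary_rep_def)
qed

lemma binary_digits_well_defined:
  assumes "x \<in> {0..1}"
  shows "\<exists>!\<alpha>. is_binary_rep x \<alpha>"
  using binary_rep_exists[OF assms] binary_rep_unique by blast

lemma block_image_well_defined:
  assumes k: "\<forall>n\<ge>1. k n \<ge> 1"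
    and \<theta>: "\<forall>n\<ge>1. bij_betw (\<theta> n) (binary_words (k n)) (binary_words (k n))"
    and \<alpha>: "\<alpha> \<in> binary_seqs"
  shows "\<exists>!\<beta>. is_block_image k \<theta> \<alpha> \<beta>"
proof -
  define s where "s n = (\<Sum>i=1..n. k i)" for n
  define w where "w n = \<theta> n (map \<alpha> (block k n))" for n
  have s_Suc: "s (Suc n) = s n + k (Suc n)" for n
    by (simp add: s_def)
  have smono: "s m \<le> s n" if "m \<le> n" for m n
    unfolding s_def using that by (intro sum_mono2) auto
  have blk: "block k (Suc n) = [Suc (s n)..<Suc (s (Suc n))]" for n
    by (simp add: block_def s_def)
  have s_ge: "n \<le> s n" for n
  proof (induction n)
    case (Suc n)
    have "k (Suc n) \<ge> 1" using k by simp
    then show ?case using Suc s_Suc[of n] by linarith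
  qed simp
  have pos: "\<exists>n. s n < j \<and> j \<le> s (Suc n)" if "j \<ge> 1" for j
  proof -
    have "\<exists>n. j \<le> s n" using s_ge by blast
    define n where "n = (LEAST n. j \<le> s n)"
    have a: "j \<le> s n" unfolding n_def by (rule LeastI_ex) fact
    have "n \<noteq> 0" using a that by (cases n) (auto simp: s_def)
    then obtain m where m: "n = Suc m" by (cases n) auto
    have "\<not> j \<le> s m" using m not_less_Least[of m "\<lambda>n. j \<le> s n"] unfolding n_def by auto
    then show ?thesis using a m by (intro exI[of _ m]) simp
  qed
  have pos_unique: "m = n" if "s n < j" "j \<le> s (Suc n)" "s m < j" "j \<le> s (Suc m)" for j m n
  proof (rule ccontr)
    assume "m \<noteq> n"
    then consider "Suc m \<le> n" | "Suc n \<le> m" by linarith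
    then show False using smono[of "Suc m" n] smono[of "Suc n" m] that by cases linarith+
  qed
  have w: "w (Suc n) \<in> binary_words (k (Suc n))" for n
  proof -
    have "map \<alpha> (block k (Suc n)) \<in> binary_words (k (Suc n))"
    proof -
      have "\<alpha> j \<in> {0,1}" if "j \<ge> 1" for j
        using \<alpha> that by (auto simp: binary_seqs_def PiE_def Pi_def)
      then have "\<alpha> ` set (block k (Suc n)) \<subseteq> {0,1}"
        unfolding blk set_upt by (intro image_subsetI) simp
      then show ?thesis
        unfolding binary_words_def mem_Collect_eq set_map length_map by (simp add: blk s_Suc)
    qed
    then show ?thesis using \<theta> unfolding w_def by (intro bij_betw_apply[of "\<theta> (Suc n)"]) auto
  qed
  define \<beta> where "\<beta> j = (if j = 0 then undefined else
      let n = (THE n. s n < j \<and> j \<le> s (Suc n)) in w (Suc n) ! (j - Suc (s n)))" for j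
  have \<beta>: "\<beta> j = w (Suc n) ! (j - Suc (s n))" if "s n < j" "j \<le> s (Suc n)" for j n
  proof -
    have "(THE n. s n < j \<and> j \<le> s (Suc n)) = n"
      using that pos_unique by (intro the_equality) auto
    then show ?thesis using that by (auto simp: \<beta>_def Let_def)
  qed
  have len: "length (w (Suc n)) = k (Suc n)" for n
    using w[of n] by (simp add: binary_words_def)
  have "\<beta> j \<in> {0,1}" if "j \<ge> 1" for j
  proof -
    obtain n where n: "s n < j" "j \<le> s (Suc n)" using pos[of j] \<open>j \<ge> 1\<close> by blast
    then have "w (Suc n) ! (j - Suc (s n)) \<in> set (w (Suc n))"
      by (intro nth_mem) (auto simp: len s_Suc)
    then show ?thesis using \<beta>[OF n] w[of n] unfolding binary_words_def by auto
  qed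
  then have "\<beta> \<in> binary_seqs"
    by (auto simp: binary_seqs_def PiE_def Pi_def extensional_def \<beta>_def)
  moreover have "map \<beta> (block k (Suc n)) = w (Suc n)" for n
    by (rule nth_equalityI) (auto simp: blk len s_Suc \<beta>[of n] simp del: upt_Suc)
  then have "map \<beta> (block k n) = w n" if "n \<ge> 1" for n
    using that by (cases n) auto
  ultimately have ex: "is_block_image k \<theta> \<alpha> \<beta>"
    by (auto simp: is_block_image_def w_def)
  have un: "\<gamma> = \<delta>" if g: "is_block_image k \<theta> \<alpha> \<gamma>" and d: "is_block_image k \<theta> \<alpha> \<delta>" for \<gamma> \<delta>
  proof (rule PiE_ext)
    show "\<gamma> \<in> {1..} \<rightarrow>\<^sub>E {0,1}" "\<delta> \<in> {1..} \<rightarrow>\<^sub>E {0,1}"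
      using that by (auto simp: is_block_image_def binary_seqs_def)
    fix j :: nat assume "j \<in> {1..}"
    then obtain n where n: "s n < j" "j \<le> s (Suc n)" using pos[of j] by auto
    have "map \<gamma> (block k (Suc n)) = map \<delta> (block k (Suc n))"
      using g d by (simp add: is_block_image_def)
    moreover have "j \<in> set (block k (Suc n))"
      using n by (auto simp: blk)
    ultimately show "\<gamma> j = \<delta> j" by (metis map_eq_conv)
  qed
  show ?thesis using ex un by blast
qed

end

theory Submission
  imports Defs
begin

text \<open>
  Every binary digit of \<open>f x\<close> (with \<open>f\<close> the block bijection function) has mean \<open>1/2\<close>, hence the mean
  of \<open>f\<close> is \<open>\<Sum>j. (1/2) / 2^j = 1/2\<close>.

  For the digits, the point is that the first \<open>N\<close> digits of a uniformly distributed \<open>x\<close> form a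
  uniformly distributed word of length \<open>N\<close> (\<open>has_integral_digit_prefix\<close>).  Thus the mean of a
  function of a block of digits is its average over all words of the length of that block
  (\<open>sum_binary_words_drop\<close>).  A digit of \<open>f x\<close> is a letter of \<open>\<theta> w\<close> with \<open>w\<close> such a block of digits of
  \<open>x\<close>, and since \<open>\<theta>\<close> permutes the words its average is that of a letter of \<open>w\<close>, namely \<open>1/2\<close>
  (\<open>sum_binary_words_nth\<close>).  The means of the digits are added by monotone convergence.
\<close>

section \<open>Sums over binary words\<close>

lemma binary_words_0: "binary_words 0 = {[]}"
  by (auto simp: binary_words_def)

lemma sum_binary_words_Suc:
  "(\<Sum>w\<in>binary_words (Suc m). g w) = (\<Sum>w\<in>binary_words m. g (0 # w)) + (\<Sum>w\<in>binary_words m. g (1 # w))"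
proof -
  have fin: "finite (binary_words m)"
    unfolding binary_words_def by (rule finite_lists_length_eq) simp
  have eq: "binary_words (Suc m) = (#) 0 ` binary_words m \<union> (#) 1 ` binary_words m"
    by (auto simp: binary_words_def length_Suc_conv image_iff)
  show ?thesis
    unfolding eq by (subst sum.union_disjoint) (auto simp: fin sum.reindex)
qed

lemma card_binary_words: "card (binary_words m) = 2 ^ m"
  using card_lists_length_eq[of "{0, 1::nat}" m] by (simp add: binary_words_def numeral_2_eq_2)

lemma sum_binary_words_drop:
  fixes g :: "nat list \<Rightarrow> real"
  shows "(\<Sum>w\<in>binary_words (a + m). g (drop a w)) = 2 ^ a * (\<Sum>w\<in>binary_words m. g w)"
  by (induction a) (simp_all add: sum_binary_words_Suc)

lemma sum_binary_words_nth:
  assumes "i < m"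
  shows "(\<Sum>w\<in>binary_words m. real (w ! i)) = 2 ^ m / 2"
  using assms
proof (induction m arbitrary: i)
  case (Suc m)
  show ?case
  proof (cases i)
    case 0
    then show ?thesis by (simp add: sum_binary_words_Suc card_binary_words)
  next
    case (Suc i')
    then have "(\<Sum>w\<in>binary_words m. real (w ! i')) = 2 ^ m / 2"
      using Suc.prems by (intro Suc.IH) simp
    then show ?thesis by (simp add: Suc sum_binary_words_Suc)
  qed
qed simp

section \<open>Uniform distribution of the initial digits\<close>

text \<open>Unlike \<open>binary_digits\<close>, this is defined by the same formula for all real \<open>x\<close>, which makes it
  compatible with doubling and with translation by 1.\<close>

definition dyadic_digit :: "nat \<Rightarrow> real \<Rightarrow> nat" where
  "dyadic_digit j x = nat (\<lfloor>2 ^ j * x\<rfloor> mod 2)"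

definition digit_prefix :: "nat \<Rightarrow> real \<Rightarrow> nat list" where
  "digit_prefix N x = map (\<lambda>j. dyadic_digit (Suc j) x) [0..<N]"

lemma dyadic_digit_Suc: "dyadic_digit (Suc j) x = dyadic_digit j (2 * x)"
  by (simp add: dyadic_digit_def mult_ac)

lemma dyadic_digit_periodic: "dyadic_digit (Suc j) (x - 1) = dyadic_digit (Suc j) x"
proof -
  have "2 ^ Suc j * (x - 1) = 2 ^ Suc j * x - of_int (2 * 2 ^ j)"
    by (simp add: algebra_simps)
  then have "\<lfloor>2 ^ Suc j * (x - 1)\<rfloor> = \<lfloor>2 ^ Suc j * x\<rfloor> - 2 * 2 ^ j"
    by (metis floor_diff_of_int)
  moreover have "(\<lfloor>2 ^ Suc j * x\<rfloor> - 2 * 2 ^ j) mod 2 = \<lfloor>2 ^ Suc j * x\<rfloor> mod 2"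
    by presburger
  ultimately show ?thesis unfolding dyadic_digit_def by simp
qed

lemma digit_prefix_Suc:
  "digit_prefix (Suc N) x = dyadic_digit 1 x # digit_prefix N (2 * x)"
  unfolding digit_prefix_def map_upt_Suc by (simp add: dyadic_digit_Suc)

lemma digit_prefix_periodic: "digit_prefix N (x - 1) = digit_prefix N x"
  by (simp add: digit_prefix_def dyadic_digit_periodic)

lemma binary_digits_eq_dyadic_digit:
  assumes "0 \<le> x" "x < 1"
  shows "binary_digits x (Suc n) = dyadic_digit (Suc n) x"
proof -
  define \<alpha> where "\<alpha> = binary_digits x"
  have "is_binary_rep x \<alpha>"
    using theI'[OF binary_digits_well_defined[of x]] assms by (simp add: \<alpha>_def binary_digits_def)
  then have \<alpha>: "\<alpha> \<in> binary_seqs" "\<not> (\<exists>N. \<forall>j>N. \<alpha> j = 1)" "x = binary_value \<alpha>"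
    using assms by (auto simp: is_binary_rep_def)
  have "\<lfloor>2 ^ Suc n * x\<rfloor> = (\<Sum>i<n. int (\<alpha> (Suc i)) * 2 ^ (Suc n - Suc i)) + int (\<alpha> (Suc n))"
    using binary_value_floor[OF \<alpha>(1,2), of "Suc n"] \<alpha>(3) by simp
  moreover have "2 dvd (\<Sum>i<n. int (\<alpha> (Suc i)) * 2 ^ (Suc n - Suc i))"
    by (intro dvd_sum) auto
  moreover have "\<alpha> (Suc n) \<in> {0, 1}"
    using \<alpha>(1) by (auto simp: binary_seqs_def PiE_def Pi_def)
  ultimately have "\<lfloor>2 ^ Suc n * x\<rfloor> mod 2 = int (\<alpha> (Suc n))"
    by auto
  then show ?thesis
    by (simp add: dyadic_digit_def \<alpha>_def)
qed

text \<open>The two halves of the unit interval correspond to the two values of the first digit, and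
  doubling maps each of them affinely onto the unit interval (modulo 1) while deleting that digit.\<close>

lemma has_integral_digit_prefix:
  fixes g :: "nat list \<Rightarrow> real"
  shows "((\<lambda>x. g (digit_prefix N x)) has_integral (\<Sum>w\<in>binary_words N. g w) / 2 ^ N) {0..1}"
proof (induction N arbitrary: g)
  case 0
  show ?case
    using has_integral_const_real[of "g []" 0 1] by (simp add: digit_prefix_def binary_words_0)
next
  case (Suc N)
  let ?S = "\<lambda>d. \<Sum>w\<in>binary_words N. g (d # w)"
  have scale: "((\<lambda>x. g (d # digit_prefix N (2 * x - c))) has_integral ?S d / 2 ^ Suc N)
      {c / 2..(1 + c) / 2}" for c d
    using has_integral_affinity_iff[of 2 "\<lambda>x. g (d # digit_prefix N x)" "-c" "?S d / 2 ^ N" 0 1]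
      Suc.IH[of "\<lambda>w. g (d # w)"]
    by (simp add: mult.commute)
  have "((\<lambda>x. g (digit_prefix (Suc N) x)) has_integral ?S 0 / 2 ^ Suc N) {0..1/2}"
  proof (rule has_integral_spike_finite[of "{1/2}"])
    show "((\<lambda>x. g (0 # digit_prefix N (2 * x))) has_integral ?S 0 / 2 ^ Suc N) {0..1/2}"
      using scale[of 0 0] by simp
    fix x :: real assume "x \<in> {0..1/2} - {1/2}"
    then have "\<lfloor>2 * x\<rfloor> = 0" by (auto simp: floor_eq_iff)
    then show "g (digit_prefix (Suc N) x) = g (0 # digit_prefix N (2 * x))"
      by (simp add: digit_prefix_Suc dyadic_digit_def)
  qed simp
  moreover have "((\<lambda>x. g (digit_prefix (Suc N) x)) has_integral ?S 1 / 2 ^ Suc N) {1/2..1}"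
  proof (rule has_integral_spike_finite[of "{1}"])
    show "((\<lambda>x. g (1 # digit_prefix N (2 * x - 1))) has_integral ?S 1 / 2 ^ Suc N) {1/2..1}"
      using scale[of 1 1] by simp
    fix x :: real assume "x \<in> {1/2..1} - {1}"
    then have "\<lfloor>2 * x\<rfloor> = 1" by (auto simp: floor_eq_iff)
    then show "g (digit_prefix (Suc N) x) = g (1 # digit_prefix N (2 * x - 1))"
      by (simp add: digit_prefix_Suc dyadic_digit_def digit_prefix_periodic)
  qed simp
  ultimately show ?case
    using has_integral_combine[of 0 "1/2" 1 "\<lambda>x. g (digit_prefix (Suc N) x)"]
    by (simp add: sum_binary_words_Suc add_divide_distrib)
qed

section \<open>Each digit of the image has mean one half\<close>

lemma block_Suc:
  "block k (Suc n) = [Suc (\<Sum>i=1..n. k i)..<Suc ((\<Sum>i=1..n. k i) + k (Suc n))]"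
  by (simp add: block_def)

lemma in_some_block:
  assumes "\<forall>n\<ge>1. k n \<ge> (1::nat)"
  shows "\<exists>n. Suc j \<in> set (block k (Suc n))"
proof -
  have ge: "m \<le> (\<Sum>i=1..m. k i)" for m
  proof (induction m)
    case (Suc m)
    have "k (Suc m) \<ge> 1" using assms by simp
    with Suc show ?case by simp
  qed simp
  have "\<exists>n. Suc j \<in> set (block k (Suc n))" if "Suc j \<le> (\<Sum>i=1..m. k i)" for m
    using that
  proof (induction m)
    case (Suc m)
    show ?case
    proof (cases "Suc j \<le> (\<Sum>i=1..m. k i)")
      case False
      then have "Suc j \<in> set (block k (Suc m))"
        using Suc.prems unfolding block_Suc by (simp del: upt_Suc)
      then show ?thesis ..
    qed (rule Suc.IH)
  qed simp
  then show ?thesis using ge[of "Suc j"] by blast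
qed

lemma is_block_image_binary_digits:
  assumes "\<forall>n\<ge>1. k n \<ge> 1"
    and "\<forall>n\<ge>1. bij_betw (\<theta> n) (binary_words (k n)) (binary_words (k n))"
    and "x \<in> {0..1}"
  shows "is_block_image k \<theta> (binary_digits x) (block_image k \<theta> (binary_digits x))"
proof -
  have "is_binary_rep x (binary_digits x)"
    unfolding binary_digits_def by (rule theI'[OF binary_digits_well_defined[OF assms(3)]])
  then have "binary_digits x \<in> binary_seqs" by (simp add: is_binary_rep_def)
  then show ?thesis
    unfolding block_image_def by (rule theI'[OF block_image_well_defined[OF assms(1,2)]])
qed

text \<open>The digit lies in one block, so it is a function of the first \<open>a + m\<close> digits of \<open>x\<close>, where \<open>m\<close> is
  the length of that block and \<open>a\<close> the total length of the earlier ones.  Its mean is therefore an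
  average over words of length \<open>m\<close>, in which the bijection \<open>\<theta> (Suc n)\<close> disappears by reindexing.\<close>

lemma has_integral_block_image_digit:
  assumes k: "\<forall>n\<ge>1. k n \<ge> 1"
    and \<theta>: "\<forall>n\<ge>1. bij_betw (\<theta> n) (binary_words (k n)) (binary_words (k n))"
  shows "((\<lambda>x. real (block_image k \<theta> (binary_digits x) (Suc j))) has_integral 1 / 2) {0..1}"
proof -
  obtain n where n: "Suc j \<in> set (block k (Suc n))"
    using in_some_block[OF k] by blast
  define a where "a = (\<Sum>i=1..n. k i)"
  define m where "m = k (Suc n)"
  have blk: "block k (Suc n) = [Suc a..<Suc (a + m)]"
    unfolding a_def m_def by (rule block_Suc)
  define i where "i = j - a"
  have i: "i < m" "j = a + i"
    using n unfolding blk i_def by auto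
  define g where "g w = real (\<theta> (Suc n) (drop a w) ! i)" for w
  have bij: "bij_betw (\<theta> (Suc n)) (binary_words m) (binary_words m)"
    using \<theta> by (simp add: m_def)
  have "(\<Sum>w\<in>binary_words (a + m). g w) = 2 ^ a * (\<Sum>w\<in>binary_words m. real (\<theta> (Suc n) w ! i))"
    unfolding g_def by (rule sum_binary_words_drop)
  also have "\<dots> = 2 ^ a * (\<Sum>w\<in>binary_words m. real (w ! i))"
    using sum.reindex_bij_betw[OF bij, of "\<lambda>w. real (w ! i)"] by simp
  also have "\<dots> = 2 ^ (a + m) / 2"
    by (simp add: sum_binary_words_nth[OF i(1)] power_add)
  finally have "(\<Sum>w\<in>binary_words (a + m). g w) / 2 ^ (a + m) = 1 / 2"
    by simp
  then have "((\<lambda>x. g (digit_prefix (a + m) x)) has_integral 1 / 2) {0..1}"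
    using has_integral_digit_prefix[of g "a + m"] by metis
  then show ?thesis
    \<comment> \<open>At 1 all binary digits are 1, while all dyadic digits are 0.\<close>
  proof (rule has_integral_spike_finite[of "{1}", rotated 2])
    fix x :: real assume x: "x \<in> {0..1} - {1}"
    define \<beta> where "\<beta> = block_image k \<theta> (binary_digits x)"
    have "map \<beta> (block k (Suc n)) = \<theta> (Suc n) (map (binary_digits x) (block k (Suc n)))"
      using is_block_image_binary_digits[OF k \<theta>, of x] x by (simp add: is_block_image_def \<beta>_def)
    also have "map (binary_digits x) (block k (Suc n)) = drop a (digit_prefix (a + m) x)"
      using x
      by (auto intro!: nth_equalityI
          simp: blk digit_prefix_def binary_digits_eq_dyadic_digit simp del: upt_Suc)
    finally have "map \<beta> (block k (Suc n)) ! i = \<theta> (Suc n) (drop a (digit_prefix (a + m) x)) ! i"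
      by simp
    moreover have "map \<beta> (block k (Suc n)) ! i = \<beta> (Suc j)"
      using i by (simp add: blk del: upt_Suc)
    ultimately show "real (block_image k \<theta> (binary_digits x) (Suc j)) = g (digit_prefix (a + m) x)"
      by (simp add: g_def \<beta>_def)
  qed simp
qed

section \<open>Summation over the digits\<close>

lemma has_integral_block_bijection_fun:
  assumes k: "\<forall>n\<ge>1. k n \<ge> 1"
    and \<theta>: "\<forall>n\<ge>1. bij_betw (\<theta> n) (binary_words (k n)) (binary_words (k n))"
  shows "(block_bijection_fun k \<theta> has_integral 1 / 2) {0..1}"
proof -
  define b where "b x i = real (block_image k \<theta> (binary_digits x) (Suc i)) / 2 ^ Suc i" for x i
  have b_int: "((\<lambda>x. \<Sum>i<n. b x i) has_integral (\<Sum>i<n. 1 / 2 / 2 ^ Suc i)) {0..1}" for n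
    unfolding b_def
    by (intro has_integral_sum has_integral_divide has_integral_block_image_digit[OF k \<theta>]) auto
  have b_sums: "b x sums block_bijection_fun k \<theta> x" if "x \<in> {0..1}" for x
  proof -
    have "block_image k \<theta> (binary_digits x) \<in> binary_seqs"
      using is_block_image_binary_digits[OF k \<theta> that] by (simp add: is_block_image_def)
    then show ?thesis
      unfolding b_def block_bijection_fun_def binary_value_def
      by (intro summable_sums binary_summable)
  qed
  have half: "(\<lambda>n. \<Sum>i<n. 1 / 2 / 2 ^ Suc i :: real) \<longlonglongrightarrow> 1 / 2"
    using sums_divide[OF geometric_half_sums, of 2] by (simp add: sums_def mult_ac)
  have int_eq: "integral {0..1} (\<lambda>x. \<Sum>i<n. b x i) = (\<Sum>i<n. 1 / 2 / 2 ^ Suc i)" for n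
    using b_int by (rule integral_unique)
  have conv: "block_bijection_fun k \<theta> integrable_on {0..1} \<and>
      (\<lambda>n. integral {0..1} (\<lambda>x. \<Sum>i<n. b x i)) \<longlonglongrightarrow> integral {0..1} (block_bijection_fun k \<theta>)"
  proof (rule monotone_convergence_increasing)
    show "(\<lambda>x. \<Sum>i<n. b x i) integrable_on {0..1}" for n
      using b_int by (rule has_integral_integrable)
    show "(\<Sum>i<n. b x i) \<le> (\<Sum>i<Suc n. b x i)" for n x
      by (simp add: b_def)
    show "(\<lambda>n. \<Sum>i<n. b x i) \<longlonglongrightarrow> block_bijection_fun k \<theta> x" if "x \<in> {0..1}" for x
      using b_sums[OF that] by (simp add: sums_def)
    show "bounded (range (\<lambda>n. integral {0..1} (\<lambda>x. \<Sum>i<n. b x i)))"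
      unfolding int_eq using half by (rule convergent_imp_bounded)
  qed
  then have "integral {0..1} (block_bijection_fun k \<theta>) = 1 / 2"
    using half LIMSEQ_unique unfolding int_eq by blast
  then show ?thesis
    using conv by (simp add: has_integral_iff)
qed

theorem theorem6:
  fixes k :: "nat \<Rightarrow> nat" and \<theta> :: "nat \<Rightarrow> nat list \<Rightarrow> nat list"
  assumes "\<forall>n\<ge>1. k n \<ge> 1"
    and "\<forall>n\<ge>1. bij_betw (\<theta> n) (binary_words (k n)) (binary_words (k n))"
  shows "integrable (lebesgue_on {0..1}) (block_bijection_fun k \<theta>) \<and>
         (LINT x|lebesgue_on {0..1}. block_bijection_fun k \<theta> x) = 1 / 2"
proof -
  have int: "(block_bijection_fun k \<theta> has_integral 1 / 2) {0..1}"
    by (rule has_integral_block_bijection_fun[OF assms])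
  have "0 \<le> block_bijection_fun k \<theta> x" if "x \<in> {0..1}" for x
    using is_block_image_binary_digits[OF assms that]
    unfolding block_bijection_fun_def binary_value_def is_block_image_def
    by (intro suminf_nonneg binary_summable) auto
  \<comment> \<open>A nonnegative gauge integrable function is Lebesgue integrable, with the same integral.\<close>
  then have "block_bijection_fun k \<theta> absolutely_integrable_on {0..1}"
    using int by (intro nonnegative_absolutely_integrable_1) (auto simp: has_integral_iff)
  then have leb: "integrable (lebesgue_on {0..1}) (block_bijection_fun k \<theta>)"
    by (simp add: absolutely_integrable_imp_integrable)
  then show ?thesis
    using int by (simp add: lebesgue_integral_eq_integral integral_unique)
qed

end
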